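(* Let $0<\lambda\le1$, let $f\in\mathcal{U}^+(\lambda)$, and let $\Gamma_1,\Gamma_2,\Gamma_3$ be the first three logarithmic coefficients of the inverse function $f^{-1}$. Then: (a) $0\le\Gamma_1\le\frac{1+\lambda}{2}$; (b) $0\le\Gamma_2\le\frac14(1+4\lambda+\lambda^2)$; (c) $0\le\Gamma_3\le\frac16(1+\lambda)(1+8\lambda+\lambda^2)$; and all of these results are sharp.
   Context: Let $\mathbb{D}=\{z\in\mathbb{C}:|z|<1\}$ and let $\mathcal{A}$ be the class of functions $f$ analytic in $\mathbb{D}$ of the form $f(z)=z+a_2z^2+a_3z^3+\cdots$. For $0<\lambda\le1$, $\mathcal{U}^+(\lambda)$ is the class of all $f\in\mathcal{A}$ such that \[ \frac{z}{f(z)}=1+b_1z+b_2z^2+\cdots,\qquad b_n\ge 0\ \text{ for all } n\ge1, \] and \[ \left|\left(\frac{z}{f(z)}\right)^2f'(z)-1\right|<\lambda,\qquad z\in\mathbb{D}. \] Every $f\in\mathcal{U}^+(\lambda)$ is univalent in $\mathbb{D}$, so by the Koebe $1/4$ theorem its inverse $f^{-1}(w)=w+A_2w^2+A_3w^3+\cdots$ is defined and analytic on $|w|<\frac14$. The logarithmic coefficients $\Gamma_n$ of $f^{-1}$ are defined by \[ \log\frac{f^{-1}(w)}{w}=\sum_{n=1}^\infty 2\Gamma_n w^n \] (with the branch of the logarithm that vanishes at $w=0$). "Sharp" means that for each $\lambda\in(0,1]$ equality in the given inequality is attained by some $f\in\mathcal{U}^+(\lambda)$. *)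

theory Defs
  imports "HOL-Complex_Analysis.Complex_Analysis"
begin

abbreviation unit_disc :: "complex set" where
  "unit_disc \<equiv> ball 0 1"

definition class_A :: "(complex \<Rightarrow> complex) set" where
  "class_A = {f. f holomorphic_on unit_disc \<and> f 0 = 0 \<and> deriv f 0 = 1}"

(* z / f z with the removable singularity at 0 filled in: the limit there is 1 for f in class_A,
   whereas HOL would give 0 / 0 = 0. *)
definition z_over :: "(complex \<Rightarrow> complex) \<Rightarrow> complex \<Rightarrow> complex" where
  "z_over f z = (if z = 0 then 1 else z / f z)"

(* The nonvanishing clause says that z / f z is defined on the whole disc,
   so that nothing hinges on division by zero. *)
definition U_plus :: "real \<Rightarrow> (complex \<Rightarrow> complex) set" where
  "U_plus lam = {f \<in> class_A.
     (\<forall>z\<in>unit_disc - {0}. f z \<noteq> 0) \<and>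
     (\<exists>b :: nat \<Rightarrow> real. b 0 = 1 \<and> (\<forall>n\<ge>1. b n \<ge> 0) \<and>
        (\<forall>z\<in>unit_disc. (\<lambda>n. complex_of_real (b n) * z ^ n) sums z_over f z)) \<and>
     (\<forall>z\<in>unit_disc. cmod ((z_over f z)\<^sup>2 * deriv f z - 1) < lam)}"

abbreviation disc_inverse :: "(complex \<Rightarrow> complex) \<Rightarrow> complex \<Rightarrow> complex" where
  "disc_inverse f \<equiv> inv_into unit_disc f"

(* Since disc_inverse f w / w tends to 1 as w tends to 0, the principal branch Ln is, near 0,
   the branch of the logarithm vanishing at w = 0. Only this germ enters the Taylor
   coefficients below. *)
definition log_inverse :: "(complex \<Rightarrow> complex) \<Rightarrow> complex \<Rightarrow> complex" where
  "log_inverse f w = (if w = 0 then 0 else Ln (disc_inverse f w / w))"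

(* The factor 2 comes from log (f^-1(w) / w) = sum_{n >= 1} 2 Gamma_n w^n. *)
definition log_inv_coeff :: "(complex \<Rightarrow> complex) \<Rightarrow> nat \<Rightarrow> complex" where
  "log_inv_coeff f n = fps_nth (fps_expansion (log_inverse f) 0) n / 2"

end

theory Submission
  imports Defs
begin

text \<open>
  Put \<open>g z = z / f z = 1 + b\<^sub>1 z + b\<^sub>2 z\<^sup>2 + \<dots>\<close>. The inverse function satisfies
  \<open>f\<inverse>(w) = w g(f\<inverse>(w))\<close>, so \<open>E(w) = f\<inverse>(w) / w\<close> solves \<open>E(w) = g(w E(w))\<close>. Comparing
  coefficients gives \<open>\<Gamma>\<^sub>1 = b\<^sub>1 / 2\<close>, \<open>\<Gamma>\<^sub>2 = (2 b\<^sub>2 + b\<^sub>1\<^sup>2) / 4\<close> and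
  \<open>\<Gamma>\<^sub>3 = (3 b\<^sub>3 + 6 b\<^sub>1 b\<^sub>2 + b\<^sub>1\<^sup>3) / 6\<close>.
  Since \<open>(z / f)\<^sup>2 f' - 1 = g - z g' - 1 = - \<Sum> (n - 1) b\<^sub>n z\<^sup>n\<close>, letting \<open>z \<rightarrow> 1\<close> yields
  \<open>\<Sum> (n - 1) b\<^sub>n \<le> lam\<close>. As \<open>g\<close> has no zero, \<open>g(- r) > 0\<close> for \<open>0 \<le> r < 1\<close>, and \<open>r \<rightarrow> 1\<close>
  gives \<open>b\<^sub>1 \<le> 1 + lam - 3 b\<^sub>3\<close>; the correction \<open>3 b\<^sub>3\<close> is what absorbs the \<open>b\<^sub>3\<close> term of \<open>\<Gamma>\<^sub>3\<close>.
  Equality occurs for \<open>g z = 1\<close> and for \<open>g z = (1 + z) (1 + lam z)\<close>.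
\<close>

section \<open>Power series of \<open>z / f z\<close> and of the defining expression\<close>

text \<open>\<open>U_plus\<close> only asserts that a coefficient sequence exists. Fixing it as a
  parameter lets the explicit extremal functions come with explicit coefficients.\<close>

locale U_plus_function =
  fixes lam :: real and f :: "complex \<Rightarrow> complex" and b :: "nat \<Rightarrow> real"
  assumes lam: "0 < lam" "lam \<le> 1"
    and f_in: "f \<in> U_plus lam"
    and b0: "b 0 = 1"
    and b_nonneg: "\<And>n. 0 \<le> b n"
    and sums_z_over: "\<And>z. z \<in> unit_disc \<Longrightarrow> (\<lambda>n. complex_of_real (b n) * z ^ n) sums z_over f z"
begin

lemma f_holomorphic: "f holomorphic_on unit_disc"
  and f_0: "f 0 = 0"
  and f_nonzero: "z \<in> unit_disc \<Longrightarrow> z \<noteq> 0 \<Longrightarrow> f z \<noteq> 0"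
  and cmod_less: "z \<in> unit_disc \<Longrightarrow> cmod ((z_over f z)\<^sup>2 * deriv f z - 1) < lam"
  using f_in by (auto simp: U_plus_def class_A_def)

lemma z_over_nonzero: "z \<in> unit_disc \<Longrightarrow> z_over f z \<noteq> 0"
  using f_nonzero by (simp add: z_over_def)

lemma f_eq: "z \<in> unit_disc \<Longrightarrow> f z = z / z_over f z"
  using f_nonzero f_0 by (simp add: z_over_def)

lemma z_over_holomorphic: "z_over f holomorphic_on unit_disc"
  by (rule power_series_holomorphic) (use sums_z_over in simp)

text \<open>Quotient rule for \<open>f z = z / z_over f z\<close>. The right-hand side is linear in
  the coefficients \<open>b n\<close>.\<close>

lemma square_times_deriv:
  assumes z: "z \<in> unit_disc"
  shows "(z_over f z)\<^sup>2 * deriv f z = z_over f z - z * deriv (z_over f) z"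
proof -
  have "(z_over f has_field_derivative deriv (z_over f) z) (at z)"
    using z_over_holomorphic z by (intro holomorphic_derivI[of _ unit_disc]) auto
  then have "((\<lambda>w. w / z_over f w) has_field_derivative
      (z_over f z - z * deriv (z_over f) z) / (z_over f z)\<^sup>2) (at z)"
    using z_over_nonzero[OF z]
    by (auto intro!: derivative_eq_intros simp: power2_eq_square)
  then have "(f has_field_derivative
      (z_over f z - z * deriv (z_over f) z) / (z_over f z)\<^sup>2) (at z)"
    by (rule has_field_derivative_transform_within_open[of _ _ _ unit_disc]) (use z f_eq in auto)
  then have "deriv f z = (z_over f z - z * deriv (z_over f) z) / (z_over f z)\<^sup>2"
    by (rule DERIV_imp_deriv)
  then show ?thesis
    using z_over_nonzero[OF z] by simp
qed

text \<open>The sign is chosen so that every coefficient except the constant term -1 is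
  nonnegative.\<close>

lemma sums_square_times_deriv:
  assumes z: "z \<in> unit_disc"
  shows "(\<lambda>n. complex_of_real ((real n - 1) * b n) * z ^ n) sums - ((z_over f z)\<^sup>2 * deriv f z)"
proof -
  have "(z_over f has_field_derivative deriv (z_over f) z) (at z)"
    using z_over_holomorphic z by (intro holomorphic_derivI[of _ unit_disc]) auto
  then have "(\<lambda>n. diffs (\<lambda>n. complex_of_real (b n)) n * z ^ n) sums deriv (z_over f) z"
    by (rule termdiffs_sums_strong[where K = 1, rotated]) (use sums_z_over z in auto)
  then have "(\<lambda>n. z * (diffs (\<lambda>n. complex_of_real (b n)) n * z ^ n)) sums (z * deriv (z_over f) z)"
    by (rule sums_mult)
  then have "(\<lambda>n. complex_of_real (real (Suc n) * b (Suc n)) * z ^ Suc n)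
      sums (z * deriv (z_over f) z)"
    by (simp add: diffs_def algebra_simps)
  then have "(\<lambda>n. complex_of_real (real n * b n) * z ^ n) sums (z * deriv (z_over f) z)"
    by (subst (asm) sums_Suc_iff) simp
  from sums_diff[OF this sums_z_over[OF z]] show ?thesis
    unfolding square_times_deriv[OF z] by (simp add: algebra_simps)
qed

section \<open>Coefficient inequalities and univalence\<close>

text \<open>At \<open>z = r\<close> in (0, 1) all terms past the constant one are nonnegative, so a
  partial sum is at most the full sum, which is below \<open>lam - 1\<close>. Working with finite
  sums makes the limit r -> 1 termwise.\<close>

lemma weighted_partial_sum_le: "(\<Sum>n<N. real n * b (Suc n)) \<le> lam"
proof (rule tendsto_upperbound)
  show "((\<lambda>r. \<Sum>n<N. real n * b (Suc n) * r ^ Suc n) \<longlongrightarrow> (\<Sum>n<N. real n * b (Suc n))) (at_left 1)"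
    by (rule tendsto_eq_intros refl | simp)+
  have "(\<Sum>n<N. real n * b (Suc n) * r ^ Suc n) \<le> lam" if r: "0 < r" "r < 1" for r
  proof -
    define t where "t = (\<lambda>n. (real n - 1) * b n * r ^ n)"
    define S where "S = (z_over f (of_real r))\<^sup>2 * deriv f (of_real r)"
    have "(\<lambda>n. complex_of_real (t n)) sums - S"
      using sums_square_times_deriv[of "of_real r"] r by (simp add: S_def t_def)
    then have "t sums Re (- S)"
      using sums_Re by fastforce
    moreover have "0 \<le> t n" if "n \<noteq> 0" for n
      using that r b_nonneg[of n] by (simp add: t_def)
    \<comment> \<open>The range contains 0, the only index with a negative term, so all omitted
      terms are nonnegative.\<close>
    ultimately have "sum t {..<Suc N} \<le> Re (- S)"
      by (metis ComplD finite_lessThan lessThan_iff zero_less_Suc sum_le_suminf sums_iff)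
    moreover have "sum t {..<Suc N} = (\<Sum>n<N. real n * b (Suc n) * r ^ Suc n) - 1"
      by (subst sum.lessThan_Suc_shift) (simp add: t_def b0)
    moreover have "\<bar>Re (S - 1)\<bar> < lam"
      using cmod_less[of "of_real r"] abs_Re_le_cmod[of "S - 1"] r by (simp add: S_def)
    ultimately show ?thesis
      by simp
  qed
  then show "\<forall>\<^sub>F r in at_left 1. (\<Sum>n<N. real n * b (Suc n) * r ^ Suc n) \<le> lam"
    unfolding eventually_at_left[OF zero_less_one] using zero_less_one by blast
qed simp

lemma weighted_summable: "summable (\<lambda>n. real n * b (Suc n))"
  by (rule summableI_nonneg_bounded[OF _ weighted_partial_sum_le]) (simp add: b_nonneg)

lemma weighted_suminf_le: "(\<Sum>n. real n * b (Suc n)) \<le> lam"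
  by (rule suminf_le_const[OF weighted_summable weighted_partial_sum_le])

lemma b2_b3_le: "b 2 + 2 * b 3 \<le> lam"
  using weighted_partial_sum_le[of 3] by (simp add: eval_nat_numeral)

text \<open>Real coefficients make \<open>z_over f\<close> real on (-1, 1). It equals 1 at 0 and has
  no zero, so by the intermediate value theorem it stays positive.\<close>

lemma z_over_neg_real:
  assumes r: "0 \<le> r" "r < 1"
  shows "0 < (\<Sum>n. b n * (- r) ^ n)" and "summable (\<lambda>n. b n * (- r) ^ n)"
proof -
  define h where "h = (\<lambda>x. Re (z_over f (of_real x)))"
  have real_sums: "(\<lambda>n. b n * x ^ n) sums h x" and of_real_h: "z_over f (of_real x) = of_real (h x)"
    if "\<bar>x\<bar> < 1" for x
  proof -
    have *: "(\<lambda>n. complex_of_real (b n * x ^ n)) sums z_over f (of_real x)"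
      using sums_z_over[of "of_real x"] that by simp
    show "(\<lambda>n. b n * x ^ n) sums h x"
      using sums_Re[OF *] by (simp add: h_def)
    then have "(\<lambda>n. complex_of_real (b n * x ^ n)) sums of_real (h x)"
      by (rule sums_of_real)
    with * show "z_over f (of_real x) = of_real (h x)"
      by (rule sums_unique2)
  qed
  have "continuous_on (complex_of_real ` {-r..0}) (z_over f)"
    using r by (intro holomorphic_on_imp_continuous_on holomorphic_on_subset[OF z_over_holomorphic]) auto
  then have cont: "continuous_on {-r..0} h"
    unfolding h_def by (intro continuous_intros continuous_on_compose2[where f = complex_of_real]) auto
  have "h 0 = 1"
    by (simp add: h_def z_over_def)
  have "0 < h (- r)"
  proof (rule ccontr)
    assume "\<not> 0 < h (- r)"
    then obtain x where "x \<in> {-r..0}" "h x = 0"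
      using IVT'[of h "-r" 0 0] \<open>h 0 = 1\<close> cont r by fastforce
    then show False
      using of_real_h[of x] z_over_nonzero[of "of_real x"] r by auto
  qed
  with real_sums[of "- r"] r show "0 < (\<Sum>n. b n * (- r) ^ n)" "summable (\<lambda>n. b n * (- r) ^ n)"
    by (auto simp: sums_iff)
qed

lemma b1_le: "b 1 \<le> 1 + lam - 3 * b 3"
proof -
  have "b 1 * r + b 3 * r ^ 3 \<le> 1 + lam - 2 * b 3" if r: "0 < r" "r < 1" for r
  proof -
    \<comment> \<open>Terms are majorized by \<open>real n * b (Suc n)\<close>, except that
      \<open>u\<close> restores the exact values for \<open>b 1\<close> and \<open>b 3\<close>. The
      odd power turns the contribution \<open>2 * b 3\<close> into \<open>- b 3 * r ^ 3\<close>, a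
      gain tending to \<open>3 * b 3\<close>.\<close>
    define u where "u = (\<lambda>n :: nat. if n = 0 then - b 1 * r else - 2 * b 3 - b 3 * r ^ 3)"
    have u: "(\<lambda>n. if n \<in> {0, 2} then u n else 0) sums (\<Sum>n\<in>{0, 2}. u n)"
      by (rule sums_If_finite_set) simp
    have "b (Suc n) * (- r) ^ Suc n \<le> real n * b (Suc n) + (if n \<in> {0, 2} then u n else 0)" for n
    proof (cases "n = 0 \<or> n = 2")
      case True
      then show ?thesis by (auto simp: u_def eval_nat_numeral)
    next
      case False
      have "(- r) ^ Suc n \<le> \<bar>(- r) ^ Suc n\<bar>"
        by simp
      also have "\<dots> = r ^ Suc n"
        using r unfolding power_abs by simp
      also have "\<dots> \<le> 1"
        using r by (intro power_le_one) auto
      also have "\<dots> \<le> real n"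
        using False by simp
      finally have "b (Suc n) * (- r) ^ Suc n \<le> b (Suc n) * real n"
        by (rule mult_left_mono) (rule b_nonneg)
      with False show ?thesis by (simp add: mult.commute)
    qed
    moreover have "(\<lambda>n. b (Suc n) * (- r) ^ Suc n) sums ((\<Sum>n. b n * (- r) ^ n) - 1)"
      using summable_sums[OF z_over_neg_real(2)[of r]] r by (subst sums_Suc_iff) (simp add: b0)
    ultimately have "(\<Sum>n. b n * (- r) ^ n) - 1 \<le> (\<Sum>n. real n * b (Suc n)) + (\<Sum>n\<in>{0, 2}. u n)"
      by (rule sums_le[OF _ _ sums_add[OF summable_sums[OF weighted_summable] u]])
    then show ?thesis
      using z_over_neg_real(1)[of r] weighted_suminf_le r by (simp add: u_def)
  qed
  then have "\<forall>\<^sub>F r in at_left 1. b 1 * r + b 3 * r ^ 3 \<le> 1 + lam - 2 * b 3"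
    unfolding eventually_at_left[OF zero_less_one] using zero_less_one by blast
  moreover have "((\<lambda>r. b 1 * r + b 3 * r ^ 3) \<longlongrightarrow> b 1 + b 3) (at_left 1)"
    by (rule tendsto_eq_intros refl | simp)+
  ultimately have "b 1 + b 3 \<le> 1 + lam - 2 * b 3"
    by (intro tendsto_upperbound[of _ _ "at_left 1"]) auto
  then show ?thesis by simp
qed

text \<open>Since \<open>1 / f z = 1 / z + b\<^sub>1 + b\<^sub>2 z + \<dots>\<close>, it suffices that the regular part
  is Lipschitz with constant \<open>\<Sum> (n - 1) b\<^sub>n \<le> lam \<le> 1\<close>.\<close>
lemma f_inj_on: "inj_on f unit_disc"
proof (rule inj_onI, rule ccontr)
  fix x y assume x: "x \<in> unit_disc" and y: "y \<in> unit_disc" and eq: "f x = f y" and "x \<noteq> y"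
  then have nz: "x \<noteq> 0" "y \<noteq> 0"
    using f_0 f_nonzero by metis+
  define c where "c n = complex_of_real (b (Suc n))" for n
  have c_sums: "(\<lambda>n. c n * z ^ Suc n) sums (z_over f z - 1)" if "z \<in> unit_disc" for z
    using sums_z_over[OF that] sums_Suc_iff[of "\<lambda>n. complex_of_real (b n) * z ^ n"]
    by (simp add: b0 c_def)
  \<comment> \<open>This is \<open>1 / f x - 1 / f y\<close> multiplied by \<open>x * y\<close>,
    without the polar parts; equality of the values of \<open>f\<close> forces the sum to be
    \<open>x - y\<close>.\<close>
  have "(\<lambda>n. y * (c n * x ^ Suc n) - x * (c n * y ^ Suc n)) sums
      (y * (z_over f x - 1) - x * (z_over f y - 1))"
    by (intro sums_diff sums_mult c_sums x y)
  moreover have "y * z_over f x = x * z_over f y"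
    using eq nz f_nonzero[OF x] by (simp add: z_over_def)
  ultimately have "(\<lambda>n. x * y * (c n * (x ^ n - y ^ n))) sums (x - y)"
    by (simp add: algebra_simps)
  then have "x - y = (\<Sum>n. x * y * (c n * (x ^ n - y ^ n)))"
    by (rule sums_unique)
  also have "norm \<dots> \<le> (\<Sum>n. cmod (x * y) * cmod (x - y) * (real n * b (Suc n)))"
  proof (rule norm_suminf_le)
    fix n
    have "cmod (x * y * (c n * (x ^ n - y ^ n))) = cmod (x * y) * b (Suc n) * cmod (x ^ n - y ^ n)"
      using b_nonneg[of "Suc n"] by (simp add: norm_mult c_def)
    also have "\<dots> \<le> cmod (x * y) * b (Suc n) * (real n * cmod (x - y))"
      using x y b_nonneg[of "Suc n"] by (intro mult_left_mono norm_power_diff) auto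
    finally show "cmod (x * y * (c n * (x ^ n - y ^ n)))
        \<le> cmod (x * y) * cmod (x - y) * (real n * b (Suc n))"
      by (simp add: algebra_simps)
  qed (intro summable_mult weighted_summable)
  also have "\<dots> = cmod (x * y) * cmod (x - y) * (\<Sum>n. real n * b (Suc n))"
    by (rule suminf_mult[OF weighted_summable])
  also have "\<dots> \<le> cmod (x * y) * cmod (x - y) * 1"
    using weighted_suminf_le lam by (intro mult_left_mono) auto
  \<comment> \<open>Strictness comes from \<open>x * y\<close> lying in the open disc, since the
    weighted sum itself may equal 1.\<close>
  also have "\<dots> < 1 * cmod (x - y)"
  proof -
    have "cmod x * cmod y < 1 * 1"
      using x y by (intro mult_strict_mono) auto
    with \<open>x \<noteq> y\<close> show ?thesis by (simp add: norm_mult)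
  qed
  finally show False by simp
qed

section \<open>Logarithmic coefficients of the inverse\<close>

lemma z_over_fps: "z_over f has_fps_expansion Abs_fps (\<lambda>n. complex_of_real (b n))"
  by (rule has_fps_expansionI)
     (use sums_z_over in \<open>auto simp: eventually_nhds intro!: exI[of _ unit_disc]\<close>)

text \<open>Writing the quotient of the inverse by \<open>w\<close> as \<open>exp (L w)\<close>
  removes the division at 0. Its coefficients follow from the functional equation, and those of
  \<open>L\<close> from the exponential series.\<close>

lemma log_inv_coeff_eq:
  shows "log_inv_coeff f 1 = of_real (b 1 / 2)"
    and "log_inv_coeff f 2 = of_real ((2 * b 2 + (b 1)\<^sup>2) / 4)"
    and "log_inv_coeff f 3 = of_real ((3 * b 3 + 6 * b 1 * b 2 + (b 1) ^ 3) / 6)"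
proof -
  define F where "F = disc_inverse f"
  define L where "L = log_inverse f"
  have F_f: "F (f z) = z" if "z \<in> unit_disc" for z
    unfolding F_def using f_inj_on that by (rule inv_into_f_f)
  \<comment> \<open>\<open>F\<close> is given by a choice operator, so its holomorphy is transferred
    from a holomorphic inverse that agrees with it on the image.\<close>
  obtain g where g: "g holomorphic_on f ` unit_disc" "\<And>z. z \<in> unit_disc \<Longrightarrow> g (f z) = z"
    using holomorphic_has_inverse[OF f_holomorphic _ f_inj_on] by (metis open_ball)
  have F_holomorphic: "F holomorphic_on f ` unit_disc"
    by (rule holomorphic_transform[OF g(1)]) (use F_f g(2) in auto)
  have op: "open (f ` unit_disc)"
    by (rule open_mapping_thm3[OF f_holomorphic _ f_inj_on]) simp
  have zero_in: "0 \<in> f ` unit_disc"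
    using f_0 by force
  have F_0: "F 0 = 0"
    using F_f[of 0] f_0 by simp
  have F_in: "F w \<in> unit_disc" if "w \<in> f ` unit_disc" for w
    using that F_f by auto
  have F_div: "F w = w * z_over f (F w)" if w: "w \<in> f ` unit_disc" for w
    using w F_f f_eq z_over_nonzero by auto
  have L_eq: "L w = Ln (z_over f (F w))" if w: "w \<in> f ` unit_disc" for w
  proof (cases "w = 0")
    case True
    then show ?thesis
      using F_0 by (simp add: L_def log_inverse_def z_over_def)
  next
    case False
    then show ?thesis
      using F_div[OF w] by (metis L_def F_def log_inverse_def nonzero_mult_div_cancel_left)
  qed
  \<comment> \<open>The exponential undoes \<open>Ln\<close> whatever the branch, so this holds on
    the whole image.\<close>
  have exp_L: "exp (L w) = z_over f (F w)" if w: "w \<in> f ` unit_disc" for w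
    using L_eq[OF w] z_over_nonzero[OF F_in[OF w]] by simp
  have "F analytic_on {0}"
    using op zero_in F_holomorphic analytic_at by blast
  moreover have "z_over f analytic_on {0}"
    using z_over_holomorphic analytic_at[of "z_over f" 0] by (meson centre_in_ball open_ball zero_less_one)
  \<comment> \<open>At \<open>w = 0\<close> the argument of \<open>Ln\<close> is 1, away from the
    branch cut.\<close>
  ultimately have "(\<lambda>w. Ln (z_over f (F w))) analytic_on {0}"
    using F_0 by (intro analytic_on_compose_gen[where g = "z_over f" and f = F and T = "{0}", unfolded o_def] analytic_intros)
      (auto simp: z_over_def)
  then have L_analytic: "L analytic_on {0}"
    using L_eq op zero_in by (subst analytic_at_cong[where g = "\<lambda>w. Ln (z_over f (F w))"])
      (auto simp: eventually_nhds)
  define Lf where "Lf = fps_expansion L 0"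
  define Ef where "Ef = fps_exp 1 oo Lf"
  have L_0: "L 0 = 0"
    by (simp add: L_def log_inverse_def)
  have Lf: "L has_fps_expansion Lf"
    unfolding Lf_def by (rule analytic_at_imp_has_fps_expansion_0[OF L_analytic])
  then have Lf_0: "Lf $ 0 = 0"
    using L_0 has_fps_expansion_imp_0_eq_fps_nth_0 by force
  have Ef: "(\<lambda>w. exp (L w)) has_fps_expansion Ef"
    unfolding Ef_def using has_fps_expansion_compose[OF has_fps_expansion_exp1 Lf Lf_0] by (simp add: o_def)
  have "(\<lambda>w. w * exp (L w)) has_fps_expansion fps_X * Ef"
    by (intro has_fps_expansion_mult has_fps_expansion_fps_X Ef)
  then have "(z_over f \<circ> (\<lambda>w. w * exp (L w))) has_fps_expansion
      (Abs_fps (\<lambda>n. complex_of_real (b n)) oo (fps_X * Ef))"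
    by (intro has_fps_expansion_compose z_over_fps) simp_all
  moreover have "\<forall>\<^sub>F w in nhds 0. (z_over f \<circ> (\<lambda>w. w * exp (L w))) w = exp (L w)"
    using op zero_in exp_L F_div by (auto simp: eventually_nhds intro!: exI[of _ "f ` unit_disc"])
  then have "(z_over f \<circ> (\<lambda>w. w * exp (L w))) has_fps_expansion G \<longleftrightarrow>
      (\<lambda>w. exp (L w)) has_fps_expansion G" for G
    by (rule has_fps_expansion_cong) simp
  ultimately have "(\<lambda>w. exp (L w)) has_fps_expansion
      (Abs_fps (\<lambda>n. complex_of_real (b n)) oo (fps_X * Ef))"
    by blast
  \<comment> \<open>The factor \<open>fps_X\<close> makes this a recursion: coefficient n on the
    right involves only coefficients of \<open>Ef\<close> below n.\<close>
  then have E_eq: "Ef = (Abs_fps (\<lambda>n. complex_of_real (b n)) oo (fps_X * Ef))"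
    by (rule fps_expansion_unique_complex[OF Ef])
  have E0: "Ef $ 0 = 1"
    by (simp add: Ef_def)
  have E1: "Ef $ 1 = b 1"
    by (subst E_eq) (simp add: fps_compose_nth fps_mult_nth E0)
  have E2: "Ef $ 2 = (b 1)\<^sup>2 + b 2"
    by (subst E_eq) (simp add: fps_compose_nth fps_mult_nth E0 E1[simplified] eval_nat_numeral)
  have E3: "Ef $ 3 = b 1 ^ 3 + 3 * b 1 * b 2 + b 3"
    using E0 E1 E2 by (subst E_eq) (simp add: fps_compose_nth fps_mult_nth eval_nat_numeral algebra_simps)
  \<comment> \<open>The same coefficients again, now from 1 + L + L^2/2 + L^3/6 + ..., to be solved
    for those of \<open>Lf\<close>.\<close>
  have "Ef $ 1 = Lf $ 1"
    by (simp add: Ef_def fps_compose_nth fps_mult_nth Lf_0)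
  moreover have "Ef $ 2 = Lf $ 2 + (Lf $ 1)\<^sup>2 / 2"
    by (simp add: Ef_def fps_compose_nth fps_mult_nth Lf_0 eval_nat_numeral)
  moreover have "Ef $ 3 = Lf $ 3 + Lf $ 1 * Lf $ 2 + (Lf $ 1) ^ 3 / 6"
    by (simp add: Ef_def fps_compose_nth fps_mult_nth Lf_0 eval_nat_numeral)
  ultimately have L1: "Lf $ 1 = of_real (b 1)"
    and L2: "Lf $ 2 = of_real (b 1 ^ 2 + b 2) - (Lf $ 1)\<^sup>2 / 2"
    and L3: "Lf $ 3 = of_real (b 1 ^ 3 + 3 * b 1 * b 2 + b 3) - Lf $ 1 * Lf $ 2 - (Lf $ 1) ^ 3 / 6"
    unfolding E1 E2 E3 by (simp_all add: algebra_simps)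
  have L2': "Lf $ 2 = of_real (b 2 + (b 1)\<^sup>2 / 2)"
    unfolding L2 L1 by (simp add: field_simps)
  have "Lf $ 3 = of_real (b 3 + 2 * b 1 * b 2 + (b 1) ^ 3 / 3)"
    unfolding L3 L2' L1 by (simp add: field_simps power2_eq_square power3_eq_cube)
  with L1 L2' show "log_inv_coeff f 1 = of_real (b 1 / 2)"
      "log_inv_coeff f 2 = of_real ((2 * b 2 + (b 1)\<^sup>2) / 4)"
      "log_inv_coeff f 3 = of_real ((3 * b 3 + 6 * b 1 * b 2 + (b 1) ^ 3) / 6)"
    by (simp_all add: log_inv_coeff_def Lf_def L_def field_simps)
qed

section \<open>Bounds for the coefficients\<close>

text \<open>The first two bounds combine the separate maxima of \<open>b 1\<close> and
  \<open>b 2\<close>. In the third these maxima already use up the whole bound, so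
  \<open>b 3\<close> must be paid for by a smaller \<open>b 1\<close>.\<close>

lemma log_inv_coeff_bounds:
  shows "log_inv_coeff f 1 \<in> complex_of_real ` {0 .. (1 + lam) / 2}"
    and "log_inv_coeff f 2 \<in> complex_of_real ` {0 .. (1 + 4 * lam + lam\<^sup>2) / 4}"
    and "log_inv_coeff f 3 \<in> complex_of_real ` {0 .. (1 + lam) * (1 + 8 * lam + lam\<^sup>2) / 6}"
proof -
  note nonneg = b_nonneg[of 1] b_nonneg[of 2] b_nonneg[of 3]
  have b1: "b 1 \<le> 1 + lam"
    using b1_le nonneg by simp
  have b2: "b 2 \<le> lam"
    using b2_b3_le nonneg by simp
  show "log_inv_coeff f 1 \<in> complex_of_real ` {0 .. (1 + lam) / 2}"
    unfolding log_inv_coeff_eq using b1 nonneg by (intro imageI) simp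
  have "(b 1)\<^sup>2 \<le> (1 + lam)\<^sup>2"
    using b1 nonneg by (intro power_mono)
  with b2 have "2 * b 2 + (b 1)\<^sup>2 \<le> 1 + 4 * lam + lam\<^sup>2"
    by (simp add: power2_sum)
  then show "log_inv_coeff f 2 \<in> complex_of_real ` {0 .. (1 + 4 * lam + lam\<^sup>2) / 4}"
    unfolding log_inv_coeff_eq using nonneg by (intro imageI) simp
  \<comment> \<open>The factor \<open>(1 + lam)\<^sup>2\<close>, at least 1, turns the linear
    estimate for \<open>b 1\<close> into one for its cube.\<close>
  have "1 * (3 * b 3) \<le> (1 + lam)\<^sup>2 * (3 * b 3)"
    using lam nonneg by (intro mult_right_mono) auto
  also have "\<dots> \<le> (1 + lam)\<^sup>2 * (1 + lam - b 1)"
    using b1_le by (intro mult_left_mono) auto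
  also have "\<dots> = (1 + lam) ^ 3 - b 1 * (1 + lam)\<^sup>2"
    by (simp add: power2_eq_square power3_eq_cube algebra_simps)
  also have "\<dots> \<le> (1 + lam) ^ 3 - b 1 ^ 3"
    using mult_left_mono[OF \<open>(b 1)\<^sup>2 \<le> (1 + lam)\<^sup>2\<close> nonneg(1)] power_Suc[of "b 1" 2]
    by simp
  finally have "3 * b 3 + b 1 ^ 3 \<le> (1 + lam) ^ 3"
    by simp
  moreover have "b 1 * b 2 \<le> (1 + lam) * lam"
    using b1 b2 nonneg lam by (intro mult_mono) auto
  moreover have "(1 + lam) * (1 + 8 * lam + lam\<^sup>2) = 6 * ((1 + lam) * lam) + (1 + lam) ^ 3"
    by (simp add: power2_eq_square power3_eq_cube algebra_simps)
  ultimately have "3 * b 3 + 6 * b 1 * b 2 + b 1 ^ 3 \<le> (1 + lam) * (1 + 8 * lam + lam\<^sup>2)"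
    by linarith
  then show "log_inv_coeff f 3 \<in> complex_of_real ` {0 .. (1 + lam) * (1 + 8 * lam + lam\<^sup>2) / 6}"
    unfolding log_inv_coeff_eq using nonneg by (intro imageI) simp
qed

end

section \<open>Extremal functions and sharpness\<close>

lemma U_plus_functionE:
  assumes "0 < lam" "lam \<le> 1" "f \<in> U_plus lam"
  obtains b where "U_plus_function lam f b"
proof -
  obtain b :: "nat \<Rightarrow> real" where b: "b 0 = 1" "\<forall>n\<ge>1. b n \<ge> 0"
      "\<forall>z\<in>unit_disc. (\<lambda>n. complex_of_real (b n) * z ^ n) sums z_over f z"
    using assms(3) by (auto simp: U_plus_def)
  then have "0 \<le> b n" for n
    by (cases n) auto
  with b assms have "U_plus_function lam f b"
    by unfold_locales auto
  then show ?thesis ..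
qed

text \<open>For a quadratic denominator the defining expression is \<open>1 - q z\<^sup>2\<close>,
  so the class condition reduces to \<open>q \<le> lam\<close>. Both extremal functions are of this
  kind.\<close>

lemma quadratic_U_plus_function:
  assumes lam: "0 < lam" "lam \<le> 1" and pq: "0 \<le> p" "0 \<le> q" "q \<le> lam"
    and nz: "\<And>z. z \<in> unit_disc \<Longrightarrow> 1 + of_real p * z + of_real q * z\<^sup>2 \<noteq> (0 :: complex)"
  shows "U_plus_function lam (\<lambda>z. z / (1 + of_real p * z + of_real q * z\<^sup>2))
    (\<lambda>n. if n = 0 then 1 else if n = 1 then p else if n = 2 then q else 0)"
    (is "U_plus_function lam ?f ?b")
proof -
  define g where "g = (\<lambda>z :: complex. 1 + of_real p * z + of_real q * z\<^sup>2)"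
  have g_nz: "g z \<noteq> 0" if "z \<in> unit_disc" for z
    using nz[OF that] by (simp add: g_def)
  have z_over: "z_over ?f z = g z" for z
    by (simp add: z_over_def g_def)
  have deriv_f: "(?f has_field_derivative (1 - of_real q * z\<^sup>2) / (g z)\<^sup>2) (at z)"
    if "z \<in> unit_disc" for z
    using nz[OF that]
    by (auto simp: g_def power2_eq_square algebra_simps intro!: derivative_eq_intros)
  have holo: "?f holomorphic_on unit_disc"
    using nz by (intro holomorphic_intros)
  have "deriv ?f 0 = 1"
    using DERIV_imp_deriv[OF deriv_f[of 0]] by (simp add: g_def)
  with holo have "?f \<in> class_A"
    by (simp add: class_A_def)
  have sums: "(\<lambda>n. complex_of_real (?b n) * z ^ n) sums z_over ?f z" for z
  proof -
    have "(\<lambda>n. complex_of_real (?b n) * z ^ n) sums (\<Sum>n\<in>{0, 1, 2}. complex_of_real (?b n) * z ^ n)"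
      by (rule sums_finite) auto
    also have "\<dots> = z_over ?f z"
      unfolding z_over by (simp add: g_def add.assoc)
    finally show ?thesis .
  qed
  have "cmod ((z_over ?f z)\<^sup>2 * deriv ?f z - 1) < lam" if z: "z \<in> unit_disc" for z
  proof -
    have "(z_over ?f z)\<^sup>2 * deriv ?f z = 1 - of_real q * z\<^sup>2"
      unfolding z_over DERIV_imp_deriv[OF deriv_f[OF z]] using g_nz[OF z] by simp
    then have "cmod ((z_over ?f z)\<^sup>2 * deriv ?f z - 1) = q * cmod z ^ 2"
      using pq by (simp only:) (simp add: norm_mult norm_power)
    also have "\<dots> \<le> lam * cmod z ^ 2"
      using pq by (intro mult_right_mono) auto
    also have "\<dots> < lam * 1"
      using lam z by (intro mult_strict_left_mono) (auto simp: power_less_one_iff)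
    finally show ?thesis by simp
  qed
  moreover have "\<exists>b :: nat \<Rightarrow> real. b 0 = 1 \<and> (\<forall>n\<ge>1. b n \<ge> 0) \<and>
      (\<forall>z\<in>unit_disc. (\<lambda>n. complex_of_real (b n) * z ^ n) sums z_over ?f z)"
    by (rule exI[of _ ?b], intro conjI ballI sums) (use pq in auto)
  moreover have "\<forall>z\<in>unit_disc - {0}. ?f z \<noteq> 0"
    using nz by simp
  ultimately have f_in: "?f \<in> U_plus lam"
    unfolding U_plus_def using \<open>?f \<in> class_A\<close> by blast
  show ?thesis
    by (rule U_plus_function.intro[OF lam f_in _ _ sums]) (use pq in auto)
qed

theorem theorem2:
  fixes lam :: real
  assumes "0 < lam" and "lam \<le> 1"
  shows
    "(\<forall>f\<in>U_plus lam.
        log_inv_coeff f 1 \<in> complex_of_real ` {0 .. (1 + lam) / 2} \<and>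
        log_inv_coeff f 2 \<in> complex_of_real ` {0 .. (1 + 4 * lam + lam\<^sup>2) / 4} \<and>
        log_inv_coeff f 3 \<in> complex_of_real ` {0 .. (1 + lam) * (1 + 8 * lam + lam\<^sup>2) / 6}) \<and>
     (\<exists>f\<in>U_plus lam. log_inv_coeff f 1 = 0) \<and>
     (\<exists>f\<in>U_plus lam. log_inv_coeff f 1 = complex_of_real ((1 + lam) / 2)) \<and>
     (\<exists>f\<in>U_plus lam. log_inv_coeff f 2 = 0) \<and>
     (\<exists>f\<in>U_plus lam. log_inv_coeff f 2 = complex_of_real ((1 + 4 * lam + lam\<^sup>2) / 4)) \<and>
     (\<exists>f\<in>U_plus lam. log_inv_coeff f 3 = 0) \<and>
     (\<exists>f\<in>U_plus lam. log_inv_coeff f 3 =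
        complex_of_real ((1 + lam) * (1 + 8 * lam + lam\<^sup>2) / 6))"
proof -
  have id: "U_plus_function lam (\<lambda>z. z / (1 + of_real 0 * z + of_real 0 * z\<^sup>2))
      (\<lambda>n. if n = 0 then 1 else if n = 1 then 0 else if n = 2 then 0 else 0)"
    using assms by (intro quadratic_U_plus_function) auto
  have "1 + of_real (1 + lam) * z + of_real lam * z\<^sup>2 \<noteq> (0 :: complex)" if z: "z \<in> unit_disc" for z
  proof
    assume "1 + of_real (1 + lam) * z + of_real lam * z\<^sup>2 = (0 :: complex)"
    \<comment> \<open>The roots -1 and \<open>- 1 / lam\<close> both lie outside the open
      disc.\<close>
    then have "(1 + z) * (1 + of_real lam * z) = 0"
      by (simp add: algebra_simps power2_eq_square)
    then have "z = - 1 \<or> of_real lam * z = - 1"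
      by (simp add: eq_neg_iff_add_eq_0 add.commute)
    moreover have "cmod (of_real lam * z) < 1 * 1"
      unfolding norm_mult using assms z by (intro mult_le_less_imp_less) auto
    ultimately show False
      using z by auto
  qed
  \<comment> \<open>Here \<open>b 1 = 1 + lam\<close>, \<open>b 2 = lam\<close> and
    \<open>b 3 = 0\<close>, which turns all estimates behind the upper bounds into
    equalities.\<close>
  then have extremal: "U_plus_function lam (\<lambda>z. z / (1 + of_real (1 + lam) * z + of_real lam * z\<^sup>2))
      (\<lambda>n. if n = 0 then 1 else if n = 1 then 1 + lam else if n = 2 then lam else 0)"
    using assms by (intro quadratic_U_plus_function) auto
  note id_coeff = U_plus_function.f_in[OF id] U_plus_function.log_inv_coeff_eq[OF id]
  note extremal_coeff = U_plus_function.f_in[OF extremal] U_plus_function.log_inv_coeff_eq[OF extremal]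
  show ?thesis
  proof (intro conjI ballI)
    fix f assume "f \<in> U_plus lam"
    with assms obtain b where "U_plus_function lam f b"
      by (rule U_plus_functionE)
    then show "log_inv_coeff f 1 \<in> complex_of_real ` {0 .. (1 + lam) / 2}"
      "log_inv_coeff f 2 \<in> complex_of_real ` {0 .. (1 + 4 * lam + lam\<^sup>2) / 4}"
      "log_inv_coeff f 3 \<in> complex_of_real ` {0 .. (1 + lam) * (1 + 8 * lam + lam\<^sup>2) / 6}"
      by (rule U_plus_function.log_inv_coeff_bounds)+
  next
    show "\<exists>f\<in>U_plus lam. log_inv_coeff f 1 = 0"
      by (rule bexI[OF _ id_coeff(1)]) (subst id_coeff, simp)
    show "\<exists>f\<in>U_plus lam. log_inv_coeff f 2 = 0"
      by (rule bexI[OF _ id_coeff(1)]) (subst id_coeff, simp)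
    show "\<exists>f\<in>U_plus lam. log_inv_coeff f 3 = 0"
      by (rule bexI[OF _ id_coeff(1)]) (subst id_coeff, simp)
    show "\<exists>f\<in>U_plus lam. log_inv_coeff f 1 = complex_of_real ((1 + lam) / 2)"
      by (rule bexI[OF _ extremal_coeff(1)]) (subst extremal_coeff, simp)
    show "\<exists>f\<in>U_plus lam. log_inv_coeff f 2 = complex_of_real ((1 + 4 * lam + lam\<^sup>2) / 4)"
      by (rule bexI[OF _ extremal_coeff(1)]) (subst extremal_coeff, rule arg_cong[where f = complex_of_real],
        simp add: power2_eq_square power3_eq_cube algebra_simps)
    show "\<exists>f\<in>U_plus lam. log_inv_coeff f 3 =
        complex_of_real ((1 + lam) * (1 + 8 * lam + lam\<^sup>2) / 6)"
      by (rule bexI[OF _ extremal_coeff(1)]) (subst extremal_coeff, rule arg_cong[where f = complex_of_real],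
        simp add: power2_eq_square power3_eq_cube algebra_simps)
  qed
qed

end
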